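(* Let $E$, $F$ be order complete Riesz spaces, $T:E\to F$ a strictly positive operator, $\emptyset\neq B\subseteq E_+$, $A:=\mathrm{Band}(B)$, and assume that $B$ is order bounded from above. Then: 1. The following are equivalent: (a) There exists $x\in B$ such that $B\subseteq\mathrm{Band}(x)$. (b) There exist $z\in B$ and positive operators $U,V:E\to F$ such that $$T=U+V,\qquad U(x)=0\ \text{ for all }x\in(\mathrm{Band}(z))^d,\qquad V(y)=0\ \text{ for all }y\in A.$$ Moreover, if the equivalent statements (a) and (b) hold then (for $x$ as in (a) and $z,U,V$ as in (b)) $$A=\mathrm{Band}(x)=\mathrm{Band}(z),\qquad U=T_A,\qquad V=T_{A^d}.$$ It follows that such $U,V$ are unique and satisfy $U\wedge V=0$ and $U\vee V=T$. 2. If $F$ has the countable sup property, and $\{b_n\}_{n\in\mathbb{N}}\subseteq B$ implies $\sup_n b_n\in B$, then there exists $x\in B$ such that $B\subseteq\mathrm{Band}(x)$.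
   Context: A Riesz space is a real ordered vector space that is a lattice; $E_+:=\{x\in E:x\ge0\}$, $x^+:=x\vee0$, $x^-:=(-x)\vee0$, $|x|:=x\vee(-x)$. It is order complete if every non-empty subset that is order bounded from above has a supremum. An operator is a linear map. $T:E\to F$ is positive if $T(x)\ge0$ whenever $x\ge0$, and strictly positive if $T(x)>0$ whenever $x>0$. $\mathcal{L}_b(E,F)$ is the set of operators mapping order bounded sets to order bounded sets; when $F$ is order complete it is an order complete Riesz space with the order $T\ge S$ iff $T(x)\ge S(x)$ for all $x\in E_+$, and $U\wedge V$, $U\vee V$ are taken in it. For $S\subseteq E$, the disjoint complement is $S^d:=\{x\in E:|x|\wedge|y|=0\text{ for all }y\in S\}$. An ideal is a vector subspace $S$ such that $|x|\ge|y|$, $x\in S$, $y\in E$ imply $y\in S$. A net $(x_\alpha)$ converges in order to $x$ if there is a net $(y_\alpha)$ decreasing with infimum $0$ such that $|x_\alpha-x|\le y_\alpha$ for each $\alpha$; a band is an ideal closed under order convergence. $\mathrm{Band}(S)$ is the smallest band containing $S$ (it equals $(S^d)^d$), and $\mathrm{Band}(x):=\mathrm{Band}(\{x\})$. If $T:E\to F$ is a positive operator, $A$ is an ideal of $E$ and $F$ is order complete, then $T_A:E\to F$ is the positive operator defined by $T_A(x):=\sup\{T(y):y\in A,\ 0\le y\le x\}$ for $x\in E_+$ and $T_A(x):=T_A(x^+)-T_A(x^-)$ for $x\in E$. A Riesz space $F$ has the countable sup property if for any $D\subseteq F$ which admits a supremum there exists an at most countable $C\subseteq D$ that admits a supremum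 and satisfies $\sup C=\sup D$. *)

theory Defs
  imports "HOL-Analysis.Analysis" "HOL-Library.Lattice_Algebras" "HOL-Library.Lub_Glb"
begin

text \<open>The class \<^class>\<open>lattice_ab_group_add_abs\<close> contributes the lattice structure and the modulus
  \<open>\<bar>x\<bar> = sup x (- x)\<close>.\<close>

class riesz_space = ordered_real_vector + lattice_ab_group_add_abs

text \<open>In a \<^class>\<open>conditionally_complete_lattice\<close>, \<open>Sup S\<close> is the supremum of \<open>S\<close> whenever \<open>S\<close> is non-empty
  and bounded above; it is an unspecified value otherwise.\<close>

class order_complete_riesz_space = riesz_space + conditionally_complete_lattice

definition disjoint_compl :: "'e::riesz_space set \<Rightarrow> 'e set" where
  "disjoint_compl S = {x. \<forall>y\<in>S. inf \<bar>x\<bar> \<bar>y\<bar> = 0}"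

definition riesz_ideal :: "'e::riesz_space set \<Rightarrow> bool" where
  "riesz_ideal S \<longleftrightarrow> subspace S \<and> (\<forall>x\<in>S. \<forall>y. \<bar>y\<bar> \<le> \<bar>x\<bar> \<longrightarrow> y \<in> S)"

text \<open>Nets are families over a directed set \<open>I\<close>, preordered by \<open>r\<close>, where \<open>(i, j) \<in> r\<close> means \<open>i \<le> j\<close>.\<close>

definition directed_set :: "'i set \<Rightarrow> 'i rel \<Rightarrow> bool" where
  "directed_set I r \<longleftrightarrow> I \<noteq> {} \<and> preorder_on I r \<and>
     (\<forall>i\<in>I. \<forall>j\<in>I. \<exists>k\<in>I. (i, k) \<in> r \<and> (j, k) \<in> r)"

definition order_converges :: "'i set \<Rightarrow> 'i rel \<Rightarrow> ('i \<Rightarrow> 'e::riesz_space) \<Rightarrow> 'e \<Rightarrow> bool" where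
  "order_converges I r x l \<longleftrightarrow>
     (\<exists>y. (\<forall>i\<in>I. \<forall>j\<in>I. (i, j) \<in> r \<longrightarrow> y j \<le> y i) \<and> isGlb UNIV (y ` I) 0 \<and>
          (\<forall>i\<in>I. \<bar>x i - l\<bar> \<le> y i))"

text \<open>A definition cannot quantify over all index types. Nets indexed by sets of pairs of elements of the
  space suffice: lemma \<open>band_order_closed\<close> below shows that a band is then closed under order convergence of
  nets over an arbitrary index type.\<close>

definition band :: "'e::riesz_space set \<Rightarrow> bool" where
  "band S \<longleftrightarrow> riesz_ideal S \<and>
     (\<forall>(I :: ('e \<times> 'e) set) r x l.
        directed_set I r \<and> (\<forall>i\<in>I. x i \<in> S) \<and> order_converges I r x l \<longrightarrow> l \<in> S)"

lemma band_order_closed: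
  fixes x :: "'i \<Rightarrow> 'e::riesz_space"
  assumes S: "band S" and d: "directed_set I r" and xS: "\<forall>i\<in>I. x i \<in> S"
    and c: "order_converges I r x l"
  shows "l \<in> S"
proof -
  obtain y where dec: "\<forall>i\<in>I. \<forall>j\<in>I. (i, j) \<in> r \<longrightarrow> y j \<le> y i"
    and glb: "isGlb UNIV (y ` I) 0" and dom: "\<forall>i\<in>I. \<bar>x i - l\<bar> \<le> y i"
    using c unfolding order_converges_def by blast
  define J where "J = (\<lambda>i. (x i, y i)) ` I"
  define q where "q = {(a, b). a \<in> J \<and> b \<in> J \<and> snd b \<le> snd a}"
  have img: "snd ` J = y ` I" by (auto simp: J_def image_image)
  have dir: "\<exists>k\<in>J. (a, k) \<in> q \<and> (b, k) \<in> q" if ab: "a \<in> J" "b \<in> J" for a b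
  proof -
    obtain i j where ij: "i \<in> I" "j \<in> I" "a = (x i, y i)" "b = (x j, y j)"
      using ab unfolding J_def by auto
    obtain k where "k \<in> I" "(i, k) \<in> r" "(j, k) \<in> r"
      using d ij unfolding directed_set_def by blast
    then show ?thesis using dec ij by (auto simp: q_def J_def intro!: bexI[of _ k])
  qed
  have "preorder_on J q"
    by (auto simp: preorder_on_def refl_on_def trans_def q_def)
  moreover have "J \<noteq> {}" using d by (auto simp: J_def directed_set_def)
  ultimately have "directed_set J q"
    unfolding directed_set_def using dir by blast
  moreover have "order_converges J q fst l"
    unfolding order_converges_def
    using glb dom img by (intro exI[of _ snd]) (auto simp: q_def J_def)
  moreover have "\<forall>i\<in>J. fst i \<in> S" using xS by (auto simp: J_def)
  ultimately show ?thesis using S unfolding band_def by metis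
qed

text \<open>Hence \<open>band hull S\<close> is the smallest band containing \<open>S\<close>.\<close>

lemma band_band_hull: "band (band hull S)"
proof (rule hull_in)
  fix \<F> :: "'a set set"
  assume F: "Ball \<F> band"
  have sub: "subspace (\<Inter>\<F>)"
  proof (intro subspace_Inter ballI)
    fix X assume "X \<in> \<F>"
    then have "band X" using F by simp
    then show "subspace X" unfolding band_def riesz_ideal_def by (elim conjE)
  qed
  have solid: "y \<in> \<Inter>\<F>" if "x \<in> \<Inter>\<F>" "\<bar>y\<bar> \<le> \<bar>x\<bar>" for x y
  proof (rule InterI)
    fix X assume X: "X \<in> \<F>"
    have "band X" using F X by simp
    then have "\<forall>x\<in>X. \<forall>y. \<bar>y\<bar> \<le> \<bar>x\<bar> \<longrightarrow> y \<in> X"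
      unfolding band_def riesz_ideal_def by (elim conjE)
    then show "y \<in> X" using that X by (meson InterD)
  qed
  have closed: "l \<in> \<Inter>\<F>"
    if "directed_set I r" "\<forall>i\<in>I. x i \<in> \<Inter>\<F>" "order_converges I r x l"
    for I :: "('a \<times> 'a) set" and r x l
  proof (rule InterI)
    fix X assume X: "X \<in> \<F>"
    have "band X" using F X by simp
    moreover have "\<forall>i\<in>I. x i \<in> X" using that(2) X by simp
    ultimately show "l \<in> X" using that(1,3) band_order_closed by metis
  qed
  have "riesz_ideal (\<Inter>\<F>)"
    unfolding riesz_ideal_def using sub solid by metis
  then show "band (\<Inter>\<F>)"
    unfolding band_def using closed by metis
qed

definition positive_operator :: "('e::riesz_space \<Rightarrow> 'f::riesz_space) \<Rightarrow> bool" where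
  "positive_operator T \<longleftrightarrow> linear T \<and> (\<forall>x\<ge>0. 0 \<le> T x)"

definition strictly_positive_operator :: "('e::riesz_space \<Rightarrow> 'f::riesz_space) \<Rightarrow> bool" where
  "strictly_positive_operator T \<longleftrightarrow> linear T \<and> (\<forall>x>0. 0 < T x)"

definition order_bounded :: "'e::riesz_space set \<Rightarrow> bool" where
  "order_bounded S \<longleftrightarrow> bdd_below S \<and> bdd_above S"

definition order_bounded_operators :: "('e::riesz_space \<Rightarrow> 'f::riesz_space) set" where
  "order_bounded_operators = {T. linear T \<and> (\<forall>S. order_bounded S \<longrightarrow> order_bounded (T ` S))}"

text \<open>The operator order compares values on the positive cone only, so it is not the pointwise order of
  the function type.\<close>

definition operator_le :: "('e::riesz_space \<Rightarrow> 'f::riesz_space) \<Rightarrow> ('e \<Rightarrow> 'f) \<Rightarrow> bool" where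
  "operator_le S T \<longleftrightarrow> (\<forall>x\<ge>0. S x \<le> T x)"

text \<open>\<open>W = U \<and> V\<close> and \<open>W = U \<or> V\<close> in the ordered vector space of order bounded operators.\<close>

definition is_operator_inf ::
    "('e::riesz_space \<Rightarrow> 'f::riesz_space) \<Rightarrow> ('e \<Rightarrow> 'f) \<Rightarrow> ('e \<Rightarrow> 'f) \<Rightarrow> bool" where
  "is_operator_inf U V W \<longleftrightarrow> {U, V, W} \<subseteq> order_bounded_operators \<and>
     operator_le W U \<and> operator_le W V \<and>
     (\<forall>S\<in>order_bounded_operators. operator_le S U \<and> operator_le S V \<longrightarrow> operator_le S W)"

definition is_operator_sup ::
    "('e::riesz_space \<Rightarrow> 'f::riesz_space) \<Rightarrow> ('e \<Rightarrow> 'f) \<Rightarrow> ('e \<Rightarrow> 'f) \<Rightarrow> bool" where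
  "is_operator_sup U V W \<longleftrightarrow> {U, V, W} \<subseteq> order_bounded_operators \<and>
     operator_le U W \<and> operator_le V W \<and>
     (\<forall>S\<in>order_bounded_operators. operator_le U S \<and> operator_le V S \<longrightarrow> operator_le W S)"

text \<open>The operator \<open>T\<^sub>A\<close>, first on the positive cone and then on the whole space.\<close>

definition component_on_cone ::
    "('e::riesz_space \<Rightarrow> 'f::order_complete_riesz_space) \<Rightarrow> 'e set \<Rightarrow> 'e \<Rightarrow> 'f" where
  "component_on_cone T A x = Sup {T y |y. y \<in> A \<and> 0 \<le> y \<and> y \<le> x}"

definition component ::
    "('e::riesz_space \<Rightarrow> 'f::order_complete_riesz_space) \<Rightarrow> 'e set \<Rightarrow> 'e \<Rightarrow> 'f" where
  "component T A x =
     (if 0 \<le> x then component_on_cone T A x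
      else component_on_cone T A (sup x 0) - component_on_cone T A (sup (- x) 0))"

definition countable_sup_property :: "'f::riesz_space itself \<Rightarrow> bool" where
  "countable_sup_property _ \<longleftrightarrow>
     (\<forall>(D :: 'f set) s. isLub UNIV D s \<longrightarrow> (\<exists>C\<subseteq>D. countable C \<and> isLub UNIV C s))"

definition band_splitting ::
    "('e::riesz_space \<Rightarrow> 'f::riesz_space) \<Rightarrow> 'e set \<Rightarrow> 'e \<Rightarrow> ('e \<Rightarrow> 'f) \<Rightarrow> ('e \<Rightarrow> 'f) \<Rightarrow> bool" where
  "band_splitting T B z U V \<longleftrightarrow>
     positive_operator U \<and> positive_operator V \<and> T = (\<lambda>x. U x + V x) \<and>
     (\<forall>x\<in>disjoint_compl (band hull {z}). U x = 0) \<and> (\<forall>y\<in>band hull B. V y = 0)"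

end

theory Submission
  imports Defs
begin

text \<open>A band \<open>A\<close> of an order complete space has a linear projection \<open>P\<close> along its disjoint complement, so
  \<open>T\<^sub>A = T \<circ> P\<close> and \<open>T - T\<^sub>A\<close> split \<open>T\<close>. If \<open>T = U + V\<close> splits at \<open>z\<close>, then the part of \<open>b \<in> B\<close> disjoint
  from \<open>z\<close> is annihilated by both \<open>U\<close> and \<open>V\<close>, hence by \<open>T\<close>, and strict positivity makes it vanish.
  Under the countable sup property the supremum of \<open>T ` B\<close> is attained at some \<open>x \<in> B\<close>, and strict
  positivity makes this \<open>x\<close> the largest element of \<open>B\<close>.\<close>

section \<open>Disjoint complements and solid subspaces\<close>

text \<open>Supplies the linear structure of the disjoint complement, on which uniqueness and
  linearity of the band projection rest.\<close>

lemma riesz_ideal_disjoint_compl: "riesz_ideal (disjoint_compl (S :: 'e::riesz_space set))"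
proof -
  have add: "inf \<bar>x + y\<bar> \<bar>a\<bar> = 0" if "inf \<bar>x\<bar> \<bar>a\<bar> = 0" "inf \<bar>y\<bar> \<bar>a\<bar> = 0" for x y a :: 'e
  proof (rule antisym)
    let ?w = "inf \<bar>x + y\<bar> \<bar>a\<bar>"
    have w: "?w \<le> \<bar>x\<bar> + \<bar>y\<bar>" "?w \<le> \<bar>a\<bar>"
      using abs_triangle_ineq[of x y] by (auto intro: le_infI1)
    \<comment> \<open>Removing |x| from \<open>?w\<close> leaves an element below both |y| and |a|,
      hence below their infimum 0. So \<open>?w\<close> is below |x| as well as below |a|.\<close>
    have "?w - \<bar>x\<bar> \<le> \<bar>y\<bar>" using w by (simp add: algebra_simps)
    moreover have "?w - \<bar>x\<bar> \<le> \<bar>a\<bar>"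
      using add_mono[OF w(2) abs_ge_zero[of x]] by (simp add: algebra_simps)
    ultimately have "?w - \<bar>x\<bar> \<le> inf \<bar>y\<bar> \<bar>a\<bar>" by simp
    then have "?w \<le> \<bar>x\<bar>" using that by simp
    then have "?w \<le> inf \<bar>x\<bar> \<bar>a\<bar>" using w by simp
    then show "?w \<le> 0" using that by simp
  qed simp
  have scale: "inf \<bar>c *\<^sub>R x\<bar> \<bar>a\<bar> = 0" if "inf \<bar>x\<bar> \<bar>a\<bar> = 0" for c :: real and x a :: 'e
  proof (rule antisym)
    let ?w = "inf \<bar>c *\<^sub>R x\<bar> \<bar>a\<bar>"
    \<comment> \<open>At least |c|, so that \<open>?w\<close> is below \<open>M\<close> times |x|;
      at least 1, so that dividing by \<open>M\<close> keeps \<open>?w\<close> below |a|.\<close>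
    define M where "M = max 1 \<bar>c\<bar>"
    have M: "M \<ge> 1" "M \<ge> c" "M \<ge> - c" by (auto simp: M_def)
    have abs: "\<bar>c *\<^sub>R x\<bar> \<le> M *\<^sub>R \<bar>x\<bar>"
    proof (rule abs_leI)
      have "c *\<^sub>R x \<le> \<bar>c\<bar> *\<^sub>R \<bar>x\<bar>" "- (c *\<^sub>R x) \<le> \<bar>c\<bar> *\<^sub>R \<bar>x\<bar>"
        using scaleR_left_mono[OF abs_ge_self[of x], of "\<bar>c\<bar>"]
          scaleR_left_mono[OF abs_ge_minus_self[of x], of "\<bar>c\<bar>"]
        by (cases "c \<ge> 0"; simp)+
      moreover have "\<bar>c\<bar> *\<^sub>R \<bar>x\<bar> \<le> M *\<^sub>R \<bar>x\<bar>" using M by (intro scaleR_right_mono) auto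
      ultimately show "c *\<^sub>R x \<le> M *\<^sub>R \<bar>x\<bar>" "- (c *\<^sub>R x) \<le> M *\<^sub>R \<bar>x\<bar>" by auto
    qed
    have w: "?w \<le> M *\<^sub>R \<bar>x\<bar>" "0 \<le> ?w" "?w \<le> \<bar>a\<bar>" using abs by (auto intro: le_infI1)
    have "(1 / M) *\<^sub>R ?w \<le> (1 / M) *\<^sub>R (M *\<^sub>R \<bar>x\<bar>)" using w M by (intro scaleR_left_mono) auto
    moreover have "(1 / M) *\<^sub>R ?w \<le> 1 *\<^sub>R ?w" using w M by (intro scaleR_right_mono) auto
    ultimately have "(1 / M) *\<^sub>R ?w \<le> inf \<bar>x\<bar> \<bar>a\<bar>" using M w by auto
    then have "(1 / M) *\<^sub>R ?w \<le> 0" using that by simp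
    then have "M *\<^sub>R ((1 / M) *\<^sub>R ?w) \<le> M *\<^sub>R 0" using M by (intro scaleR_left_mono) auto
    then show "?w \<le> 0" using M by simp
  qed simp
  have solid: "inf \<bar>y\<bar> \<bar>a\<bar> = 0" if "inf \<bar>x\<bar> \<bar>a\<bar> = 0" "\<bar>y\<bar> \<le> \<bar>x\<bar>" for x y a :: 'e
    using that inf_mono[OF that(2) order_refl, of "\<bar>a\<bar>"] by (intro antisym) auto
  have "subspace (disjoint_compl S)"
    unfolding subspace_def disjoint_compl_def using add scale by (auto simp: inf_absorb1)
  then show ?thesis
    unfolding riesz_ideal_def using solid by (auto simp: disjoint_compl_def)
qed

lemma band_ideal: "band S \<Longrightarrow> riesz_ideal S"
  by (simp add: band_def)

lemma riesz_ideal_subspace: "riesz_ideal S \<Longrightarrow> subspace S"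
  by (simp add: riesz_ideal_def)

lemma riesz_ideal_solid:
  assumes "riesz_ideal S" "x \<in> S" "0 \<le> y" "y \<le> x"
  shows "y \<in> S"
proof -
  have "\<bar>y\<bar> \<le> \<bar>x\<bar>" using assms by simp
  then show ?thesis using assms unfolding riesz_ideal_def by blast
qed

lemma riesz_ideal_abs:
  assumes "riesz_ideal S" "x \<in> S"
  shows "\<bar>x\<bar> \<in> S"
proof -
  have "\<bar>\<bar>x\<bar>\<bar> \<le> \<bar>x\<bar>" by simp
  then show ?thesis using assms unfolding riesz_ideal_def by blast
qed

lemma disjoint_compl_Int:
  assumes "x \<in> S" "x \<in> disjoint_compl S"
  shows "x = 0"
  using assms unfolding disjoint_compl_def by fastforce

section \<open>Band decomposition and the band projection\<close>

text \<open>The component \<open>p\<close> is the supremum of the elements of \<open>A\<close> in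
  [0, x]. These form an upward directed set converging in order to \<open>p\<close>, so
  \<open>p\<close> stays in the band; any overlap of \<open>x - p\<close> with \<open>A\<close>
  could be added to \<open>p\<close>, against its being an upper bound.\<close>

lemma band_decomp_nonneg:
  fixes A :: "'e::order_complete_riesz_space set"
  assumes A: "band A" and x: "0 \<le> x"
  obtains p where "p \<in> A" "x - p \<in> disjoint_compl A" "0 \<le> p" "p \<le> x"
proof -
  note ideal = band_ideal[OF A] and sub = riesz_ideal_subspace[OF band_ideal[OF A]]
  define S where "S = {y \<in> A. 0 \<le> y \<and> y \<le> x}"
  define p where "p = Sup S"
  have S0: "0 \<in> S" using x sub by (simp add: S_def subspace_0)
  have bdd: "bdd_above S" by (auto simp: S_def bdd_above_def)
  have upper: "y \<le> p" if "y \<in> S" for y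
    unfolding p_def using that bdd by (rule cSup_upper)
  have least: "p \<le> u" if "\<And>y. y \<in> S \<Longrightarrow> y \<le> u" for u
    unfolding p_def using S0 that by (intro cSup_least) auto
  have px: "p \<le> x" by (rule least) (simp add: S_def)
  have sup: "sup y z \<in> S" if "y \<in> S" "z \<in> S" for y z
  proof -
    \<comment> \<open>For nonnegative elements the sum dominates the supremum, so solidity of
      \<open>A\<close> applies.\<close>
    have "sup y z \<le> y + z" using that by (simp add: S_def)
    moreover have "y + z \<in> A" using that sub by (simp add: S_def subspace_add)
    moreover have nonneg: "0 \<le> sup y z" using that by (simp add: S_def le_supI1)
    ultimately have "sup y z \<in> A" using riesz_ideal_solid[OF ideal] by blast
    then show ?thesis using that nonneg by (simp add: S_def)
  qed
  \<comment> \<open>The set \<open>S\<close> indexes itself: the net is the identity, dominated by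
    the decreasing net \<open>p - i\<close>.\<close>
  define r where "r = {(i, j). i \<in> S \<and> j \<in> S \<and> i \<le> j}"
  have dir: "directed_set S r"
    unfolding directed_set_def
  proof (intro conjI ballI)
    show "S \<noteq> {}" using S0 by blast
    show "preorder_on S r"
      by (auto simp: preorder_on_def refl_on_def trans_def r_def)
    fix i j assume "i \<in> S" "j \<in> S"
    then show "\<exists>k\<in>S. (i, k) \<in> r \<and> (j, k) \<in> r"
      using sup by (intro bexI[of _ "sup i j"]) (auto simp: r_def)
  qed
  have conv: "order_converges S r (\<lambda>i. i) p"
    unfolding order_converges_def
  proof (intro exI[of _ "\<lambda>i. p - i"] conjI ballI impI)
    show "p - j \<le> p - i" if "(i, j) \<in> r" for i j using that by (auto simp: r_def)
    show "\<bar>i - p\<bar> \<le> p - i" if "i \<in> S" for i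
      using upper[OF that] by (metis abs_minus_commute abs_of_nonneg diff_ge_0_iff_ge order_refl)
    have "u \<le> 0" if u: "\<And>y. y \<in> S \<Longrightarrow> u \<le> p - y" for u
    proof -
      \<comment> \<open>A lower bound \<open>u\<close> of all \<open>p - y\<close> makes
        \<open>p - u\<close> an upper bound of \<open>S\<close>.\<close>
      have "p \<le> p - u" using u by (intro least) (simp add: algebra_simps)
      then show ?thesis by simp
    qed
    then show "isGlb UNIV ((\<lambda>i. p - i) ` S) 0"
      using upper
      by (auto simp: isGlb_def greatestP_def isLb_def setge_def setle_def)
  qed
  have pA: "p \<in> A"
    by (rule band_order_closed[OF A dir _ conv]) (simp add: S_def)
  have p0: "0 \<le> p" using upper S0 by blast
  have "inf \<bar>x - p\<bar> \<bar>a\<bar> = 0" if a: "a \<in> A" for a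
  proof (rule antisym)
    let ?w = "inf \<bar>x - p\<bar> \<bar>a\<bar>"
    \<comment> \<open>The overlap \<open>?w\<close> is in \<open>A\<close> by solidity and fits
      below \<open>x - p\<close>, so \<open>p + ?w\<close> is again a member of \<open>S\<close> and
      cannot exceed \<open>p\<close>.\<close>
    have "?w \<in> A"
      using riesz_ideal_abs[OF ideal a] by (rule riesz_ideal_solid[OF ideal]) auto
    then have pw: "p + ?w \<in> A" using pA sub by (simp add: subspace_add)
    have "?w \<le> x - p" using px by (metis abs_of_nonneg diff_ge_0_iff_ge inf.cobounded1)
    then have "p + ?w \<le> x" by (simp add: algebra_simps)
    then have "p + ?w \<in> S" using p0 pw by (simp add: S_def)
    then show "?w \<le> 0" using upper by fastforce
  qed simp
  then show thesis
    using that pA p0 px by (auto simp: disjoint_compl_def)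
qed

text \<open>Described by the decomposition rather than as a supremum, so that linearity follows from
  uniqueness and no sign condition on \<open>x\<close> enters.\<close>

definition band_proj :: "'e::order_complete_riesz_space set \<Rightarrow> 'e \<Rightarrow> 'e" where
  "band_proj A x = (THE p. p \<in> A \<and> x - p \<in> disjoint_compl A)"

text \<open>The difference of two candidates lies in both \<open>A\<close> and its disjoint
  complement, so it is disjoint from itself.\<close>

lemma band_decomp_unique:
  assumes A: "band A"
    and p: "p \<in> A" "x - p \<in> disjoint_compl A" and q: "q \<in> A" "x - q \<in> disjoint_compl A"
  shows "p = q"
proof -
  have "p - q \<in> A"
    using p q riesz_ideal_subspace[OF band_ideal[OF A]] by (simp add: subspace_diff)
  moreover have "(x - q) - (x - p) \<in> disjoint_compl A"
    by (rule subspace_diff[OF riesz_ideal_subspace[OF riesz_ideal_disjoint_compl] q(2) p(2)])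
  ultimately show ?thesis using disjoint_compl_Int[of "p - q" A] by simp
qed

lemma eq_diff_pos_neg_parts:
  fixes x :: "'e::riesz_space"
  shows "x = sup x 0 - sup (- x) 0"
  using prts[of x] neg_inf_eq_sup[of x 0] by (simp add: pprt_def nprt_def)

lemma band_proj_eqI:
  assumes "band A" "p \<in> A" "x - p \<in> disjoint_compl A"
  shows "band_proj A x = p"
  unfolding band_proj_def using assms band_decomp_unique by blast

text \<open>Both claims follow by decomposing the positive and negative parts separately and
  subtracting, since \<open>A\<close> and its disjoint complement are subspaces.\<close>

lemma
  assumes A: "band A"
  shows band_proj_in: "band_proj A x \<in> A"
    and band_proj_compl: "x - band_proj A x \<in> disjoint_compl A"
proof -
  obtain p where p: "p \<in> A" "sup x 0 - p \<in> disjoint_compl A"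
    using band_decomp_nonneg[OF A, of "sup x 0"] by auto
  obtain q where q: "q \<in> A" "sup (- x) 0 - q \<in> disjoint_compl A"
    using band_decomp_nonneg[OF A, of "sup (- x) 0"] by auto
  note x = eq_diff_pos_neg_parts[of x]
  have "p - q \<in> A"
    using p q riesz_ideal_subspace[OF band_ideal[OF A]] by (simp add: subspace_diff)
  moreover have "(sup x 0 - p) - (sup (- x) 0 - q) \<in> disjoint_compl A"
    by (rule subspace_diff[OF riesz_ideal_subspace[OF riesz_ideal_disjoint_compl] p(2) q(2)])
  then have "(sup x 0 - sup (- x) 0) - (p - q) \<in> disjoint_compl A"
    by (simp only: add_diff_eq diff_diff_eq2 diff_add_eq diff_diff_add ac_simps)
  then have "x - (p - q) \<in> disjoint_compl A"
    by (simp only: x[symmetric])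
  ultimately show "band_proj A x \<in> A" "x - band_proj A x \<in> disjoint_compl A"
    using band_proj_eqI[OF A] by auto
qed

lemma band_proj_id: "band A \<Longrightarrow> x \<in> A \<Longrightarrow> band_proj A x = x"
  using subspace_0[OF riesz_ideal_subspace[OF riesz_ideal_disjoint_compl]]
  by (intro band_proj_eqI) auto

lemma band_proj_zero: "band A \<Longrightarrow> x \<in> disjoint_compl A \<Longrightarrow> band_proj A x = 0"
  using subspace_0[OF riesz_ideal_subspace[OF band_ideal]]
  by (intro band_proj_eqI) auto

lemma linear_band_proj:
  assumes A: "band A"
  shows "linear (band_proj A)"
proof
  note sub = riesz_ideal_subspace[OF band_ideal[OF A]]
  note subd = riesz_ideal_subspace[OF riesz_ideal_disjoint_compl[of A]]
  show "band_proj A (x + y) = band_proj A x + band_proj A y" for x y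
    using subspace_add[OF subd band_proj_compl[OF A, of x] band_proj_compl[OF A, of y]]
    by (intro band_proj_eqI[OF A] subspace_add[OF sub] band_proj_in[OF A]) (simp add: algebra_simps)
  show "band_proj A (c *\<^sub>R x) = c *\<^sub>R band_proj A x" for c x
    using subspace_scale[OF subd band_proj_compl[OF A, of x], of c]
    by (intro band_proj_eqI[OF A] subspace_scale[OF sub] band_proj_in[OF A]) (simp add: algebra_simps)
qed

lemma
  assumes A: "band A" and x: "0 \<le> x"
  shows band_proj_nonneg: "0 \<le> band_proj A x" and band_proj_le: "band_proj A x \<le> x"
  using band_decomp_nonneg[OF A x] band_proj_eqI[OF A] by metis+

section \<open>Positive operators\<close>

lemma positive_operator_mono:
  assumes "positive_operator T" "x \<le> y"
  shows "T x \<le> T y"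
proof -
  have "0 \<le> T (y - x)" using assms by (simp add: positive_operator_def)
  then show ?thesis using assms by (simp add: positive_operator_def linear_diff)
qed

lemma strictly_positive_imp_positive:
  assumes "strictly_positive_operator T"
  shows "positive_operator T"
  using assms unfolding strictly_positive_operator_def positive_operator_def
  by (metis linear_0 order_le_less)

lemma strictly_positive_eq_0:
  assumes "strictly_positive_operator T" "0 \<le> x" "T x = 0"
  shows "x = 0"
  using assms unfolding strictly_positive_operator_def by (metis order_le_less less_irrefl)

lemma positive_imp_order_bounded:
  assumes "positive_operator T"
  shows "T \<in> order_bounded_operators"
  using assms positive_operator_mono[OF assms]
  unfolding order_bounded_operators_def order_bounded_def bdd_below_def bdd_above_def
  by (auto simp: positive_operator_def) blast+

section \<open>Components of an operator as compositions with projections\<close>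

text \<open>The supremum defining the component is a maximum, attained at \<open>P x\<close>,
  because \<open>T\<close> is monotone. A general \<open>P\<close> covers both the band projection
  and its complement.\<close>

lemma component_eqI:
  fixes T :: "'e::riesz_space \<Rightarrow> 'f::order_complete_riesz_space"
  assumes T: "positive_operator T" and P: "linear P"
    and max: "\<And>x. 0 \<le> x \<Longrightarrow> P x \<in> A \<and> 0 \<le> P x \<and> P x \<le> x"
      "\<And>x y. y \<in> A \<Longrightarrow> 0 \<le> y \<Longrightarrow> y \<le> x \<Longrightarrow> y \<le> P x"
  shows "component T A = (\<lambda>x. T (P x))"
proof
  have cone: "component_on_cone T A x = T (P x)" if "0 \<le> x" for x
    unfolding component_on_cone_def
    using max that positive_operator_mono[OF T] by (intro cSup_eq_maximum) blast+
  fix x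
  note x = eq_diff_pos_neg_parts[of x]
  have "T (P (y - z)) = T (P y) - T (P z)" for y z
    using T P by (simp add: positive_operator_def linear_diff)
  \<comment> \<open>This settles the second branch of \<open>component\<close>; for nonnegative
    \<open>x\<close> the fact \<open>cone\<close> suffices.\<close>
  from this[of "sup x 0" "sup (- x) 0", folded x] show "component T A x = T (P x)"
    by (simp add: component_def cone)
qed

lemma component_band:
  assumes T: "positive_operator T" and A: "band A"
  shows "component T A = (\<lambda>x. T (band_proj A x))"
proof (rule component_eqI[OF T linear_band_proj[OF A]])
  show "band_proj A x \<in> A \<and> 0 \<le> band_proj A x \<and> band_proj A x \<le> x" if "0 \<le> x" for x
    using that A by (simp add: band_proj_in band_proj_nonneg band_proj_le)
  \<comment> \<open>The projection of \<open>x - y\<close> is nonnegative, and the projection fixes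
    \<open>y\<close>.\<close>
  show "y \<le> band_proj A x" if "y \<in> A" "0 \<le> y" "y \<le> x" for x y
    using that band_proj_nonneg[OF A, of "x - y"]
    by (simp add: linear_diff[OF linear_band_proj[OF A]] band_proj_id[OF A])
qed

lemma component_disjoint_compl:
  assumes T: "positive_operator T" and A: "band A"
  shows "component T (disjoint_compl A) = (\<lambda>x. T (x - band_proj A x))"
proof (rule component_eqI[OF T])
  show "linear (\<lambda>x. x - band_proj A x)"
    using linear_band_proj[OF A] by (intro linear_compose_sub) (auto simp: linear_id[unfolded id_def])
  show "x - band_proj A x \<in> disjoint_compl A \<and> 0 \<le> x - band_proj A x \<and> x - band_proj A x \<le> x"
    if "0 \<le> x" for x
    using that A by (simp add: band_proj_compl band_proj_nonneg band_proj_le)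
  \<comment> \<open>Here the projection annihilates \<open>y\<close>, so the projection of
    \<open>x - y\<close> is that of \<open>x\<close>; it is at most \<open>x - y\<close>.\<close>
  show "y \<le> x - band_proj A x" if "y \<in> disjoint_compl A" "0 \<le> y" "y \<le> x" for x y
    using that band_proj_le[OF A, of "x - y"]
    by (simp add: linear_diff[OF linear_band_proj[OF A]] band_proj_zero[OF A] algebra_simps)
qed

section \<open>Splittings of \<open>T\<close> along a band\<close>

lemma band_hull_mono_eq:
  assumes "x \<in> B" "B \<subseteq> band hull {x}"
  shows "band hull B = band hull {x}"
proof
  show "band hull B \<subseteq> band hull {x}" by (rule hull_minimal[where S=band, OF assms(2) band_band_hull])
  show "band hull {x} \<subseteq> band hull B" using assms(1) by (intro hull_mono) simp
qed

text \<open>From (a) to (b): \<open>T\<close> is composed with the projection onto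
  \<open>band hull B\<close> and with its complement. By (a) this band is
  \<open>band hull {x}\<close>, so the first operator vanishes where required.\<close>

lemma band_splitting_exists:
  fixes T :: "'e::order_complete_riesz_space \<Rightarrow> 'f::riesz_space"
  assumes T: "positive_operator T" and x: "x \<in> B" "B \<subseteq> band hull {x}"
  shows "\<exists>U V. band_splitting T B x U V"
proof -
  let ?A = "band hull B"
  note A = band_band_hull[of B] and eq = band_hull_mono_eq[OF x]
  note lin = linear_band_proj[OF A]
  have T': "linear T" "\<And>x. 0 \<le> x \<Longrightarrow> 0 \<le> T x" using T by (auto simp: positive_operator_def)
  let ?U = "\<lambda>x. T (band_proj ?A x)" and ?V = "\<lambda>x. T (x - band_proj ?A x)"
  have "linear (\<lambda>x. x - band_proj ?A x)"
    using lin by (intro linear_compose_sub) (auto simp: linear_id[unfolded id_def])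
  then have "linear ?U" "linear ?V"
    using linear_compose[OF lin T'(1)] linear_compose[OF _ T'(1)] by (auto simp: o_def)
  then have "positive_operator ?U" "positive_operator ?V"
    using T' A by (auto simp: positive_operator_def band_proj_nonneg band_proj_le)
  moreover have "?U y = 0" if "y \<in> disjoint_compl (band hull {x})" for y
    using that band_proj_zero[OF A] T' by (simp add: eq[symmetric] linear_0)
  moreover have "?V y = 0" if "y \<in> ?A" for y
    using that band_proj_id[OF A] T' by (simp add: linear_0)
  ultimately have "band_splitting T B x ?U ?V"
    unfolding band_splitting_def using T' by (auto simp: linear_diff)
  then show ?thesis by blast
qed

lemma band_splitting_imp_subset:
  fixes T :: "'e::order_complete_riesz_space \<Rightarrow> 'f::riesz_space"
  assumes T: "strictly_positive_operator T" and B: "B \<subseteq> {x. 0 \<le> x}"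
    and UV: "band_splitting T B z U V"
  shows "B \<subseteq> band hull {z}"
proof
  fix b assume b: "b \<in> B"
  let ?Z = "band hull {z}"
  note Z = band_band_hull[of "{z}"]
  define q where "q = b - band_proj ?Z b"
  have b0: "0 \<le> b" using b B by auto
  have q: "0 \<le> q" "q \<le> b" using Z b0 by (simp_all add: q_def band_proj_le band_proj_nonneg)
  have "b \<in> band hull B" using b hull_subset[of B band] by blast
  \<comment> \<open>Lying in \<open>band hull B\<close> gives V q = 0, and disjointness from
    \<open>band hull {z}\<close> gives U q = 0.\<close>
  then have "q \<in> band hull B"
    by (rule riesz_ideal_solid[OF band_ideal[OF band_band_hull] _ q])
  moreover have "q \<in> disjoint_compl ?Z" unfolding q_def by (rule band_proj_compl[OF Z])
  ultimately have "T q = 0" using UV by (auto simp: band_splitting_def)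
  then have "b = band_proj ?Z b" using strictly_positive_eq_0[OF T q(1)] by (simp add: q_def)
  then show "b \<in> ?Z" using band_proj_in[OF Z] by metis
qed

text \<open>As \<open>band hull B\<close> equals \<open>band hull {z}\<close>, \<open>U\<close>
  kills the part of \<open>x\<close> disjoint from it and \<open>V\<close> kills the projected part.
  Evaluating \<open>T\<close> on each part therefore determines both operators.\<close>

lemma band_splitting_eq:
  fixes T :: "'e::order_complete_riesz_space \<Rightarrow> 'f::riesz_space"
  assumes T: "strictly_positive_operator T" and B: "B \<subseteq> {x. 0 \<le> x}" and z: "z \<in> B"
    and UV: "band_splitting T B z U V"
  shows "U = (\<lambda>x. T (band_proj (band hull B) x))" "V = (\<lambda>x. T (x - band_proj (band hull B) x))"
proof -
  let ?A = "band hull B"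
  let ?P = "band_proj ?A"
  note A = band_band_hull[of B]
  note eq = band_hull_mono_eq[OF z band_splitting_imp_subset[OF T B UV]]
  have lin: "linear U" "linear V" and TUV: "T x = U x + V x" for x
    using UV by (auto simp: band_splitting_def positive_operator_def)
  have U: "U (x - ?P x) = 0" for x
    using UV band_proj_compl[OF A, of x] eq by (auto simp: band_splitting_def)
  have V: "V (?P x) = 0" for x
    using UV band_proj_in[OF A, of x] by (auto simp: band_splitting_def)
  have "U x = T (?P x)" "V x = T (x - ?P x)" for x
    using U[of x] V[of x] lin by (simp_all add: TUV linear_diff)
  then show "U = (\<lambda>x. T (?P x))" "V = (\<lambda>x. T (x - ?P x))" by auto
qed

text \<open>\<open>U\<close> and \<open>V\<close> live on complementary parts of each
  \<open>x\<close>, so an operator comparable to both can be tested on the two parts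
  separately.\<close>

lemma band_splitting_operator_inf_sup:
  fixes T :: "'e::order_complete_riesz_space \<Rightarrow> 'f::riesz_space"
  assumes T: "strictly_positive_operator T" and B: "B \<subseteq> {x. 0 \<le> x}" and z: "z \<in> B"
    and UV: "band_splitting T B z U V"
  shows "is_operator_inf U V (\<lambda>_. 0)" "is_operator_sup U V T"
proof -
  let ?P = "band_proj (band hull B)"
  note A = band_band_hull[of B]
  note eqs = band_splitting_eq[OF T B z UV]
  have pos: "positive_operator U" "positive_operator V" "positive_operator T"
    "positive_operator (\<lambda>_::'e. 0::'f)"
    using UV strictly_positive_imp_positive[OF T]
    by (auto simp: band_splitting_def positive_operator_def linear_iff)
  then have mem: "{U, V, \<lambda>_. 0} \<subseteq> order_bounded_operators" "{U, V, T} \<subseteq> order_bounded_operators"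
    using positive_imp_order_bounded by auto
  have nonneg: "0 \<le> U x" "0 \<le> V x" if "0 \<le> x" for x
    using pos that by (auto simp: positive_operator_def)
  have TUV: "T x = U x + V x" for x using UV by (simp add: band_splitting_def)
  have parts: "0 \<le> ?P x" "0 \<le> x - ?P x" if "0 \<le> x" for x
    using that A by (simp_all add: band_proj_nonneg band_proj_le)
  have P_idem: "?P (?P x) = ?P x" for x
    by (intro band_proj_id[OF A] band_proj_in[OF A])
  have T0: "T 0 = 0" using pos by (simp add: positive_operator_def linear_0)
  have U0: "U (x - ?P x) = 0" and V0: "V (?P x) = 0" for x
    by (simp_all add: eqs P_idem T0 band_proj_zero[OF A band_proj_compl[OF A]])
  have split: "S x = S (?P x) + S (x - ?P x)" if "S \<in> order_bounded_operators"
    for S :: "'e \<Rightarrow> 'f" and x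
    using that by (simp add: order_bounded_operators_def linear_diff)
  have inf: "S x \<le> 0"
    if S: "S \<in> order_bounded_operators" "operator_le S U" "operator_le S V" and x: "0 \<le> x" for S x
  proof -
    \<comment> \<open>On each part \<open>S\<close> is compared with the operator that vanishes
      there.\<close>
    have "S (?P x) \<le> V (?P x)" "S (x - ?P x) \<le> U (x - ?P x)"
      using S(2,3) parts[OF x] unfolding operator_le_def by blast+
    then have "S (?P x) + S (x - ?P x) \<le> 0" using U0 V0 add_mono by fastforce
    then show ?thesis using split[OF S(1)] by metis
  qed
  have sup: "T x \<le> S x"
    if S: "S \<in> order_bounded_operators" "operator_le U S" "operator_le V S" and x: "0 \<le> x" for S x
  proof -
    \<comment> \<open>Now each part is paired with the operator that agrees with \<open>T\<close> on
      it.\<close>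
    have "U (?P x) \<le> S (?P x)" "V (x - ?P x) \<le> S (x - ?P x)"
      using S(2,3) parts[OF x] unfolding operator_le_def by blast+
    moreover have "T x = U (?P x) + V (x - ?P x)"
      using U0[of x] V0[of x] pos TUV[of x] by (simp add: positive_operator_def linear_diff)
    ultimately show ?thesis using split[OF S(1)] add_mono by metis
  qed
  show "is_operator_inf U V (\<lambda>_. 0)"
    unfolding is_operator_inf_def using mem(1) nonneg inf unfolding operator_le_def by blast
  show "is_operator_sup U V T"
    unfolding is_operator_sup_def using mem(2) nonneg sup unfolding operator_le_def
    by (simp add: TUV)
qed

section \<open>The countable sup property and a largest element\<close>

text \<open>The countable sup property is available in the codomain, so it is applied to
  \<open>T\<close> B\<open>. Closure under sequences serves twice: to reach the supremum of\<close>T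
  \<open>B\<close> at one point, and to form binary suprema in \<open>B\<close>.\<close>

lemma countable_sup_property_maximum:
  fixes T :: "'e::order_complete_riesz_space \<Rightarrow> 'f::order_complete_riesz_space"
  assumes T: "strictly_positive_operator T" and ne: "B \<noteq> {}" and bdd: "bdd_above B"
    and csp: "countable_sup_property TYPE('f)"
    and closed: "\<And>b :: nat \<Rightarrow> 'e. range b \<subseteq> B \<Longrightarrow> (SUP n. b n) \<in> B"
  obtains x where "x \<in> B" "\<And>b. b \<in> B \<Longrightarrow> b \<le> x"
proof -
  note Tpos = strictly_positive_imp_positive[OF T]
  note mono = positive_operator_mono[OF Tpos]
  define s where "s = Sup (T ` B)"
  have bddT: "bdd_above (T ` B)" using bdd mono unfolding bdd_above_def by blast
  have upper: "T b \<le> s" if "b \<in> B" for b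
    unfolding s_def using that bddT by (intro cSup_upper) auto
  have "isLub UNIV (T ` B) s"
    using upper ne cSup_least[of "T ` B"]
    by (auto simp: isLub_def leastP_def isUb_def setle_def setge_def s_def)
  then obtain C where C: "C \<subseteq> T ` B" "countable C" "isLub UNIV C s"
    using csp unfolding countable_sup_property_def by blast
  obtain b0 where b0: "b0 \<in> B" using ne by blast
  \<comment> \<open>Countably many preimages in \<open>B\<close> of the values in \<open>C\<close>,
    to be enumerated as a sequence.\<close>
  obtain D where D: "D \<subseteq> B" "countable D" "C = T ` D"
    using C countable_subset_image[of C T B] by auto
  \<comment> \<open>\<open>C\<close> may be empty when \<open>'f\<close> is trivial, so \<open>b0\<close> is added before enumerating.\<close>
  define b where "b = from_nat_into (insert b0 D)"
  have rb: "range b = insert b0 D" unfolding b_def using D by (intro range_from_nat_into) auto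
  have bB: "range b \<subseteq> B" using rb D b0 by auto
  define x where "x = (SUP n. b n)"
  have x: "x \<in> B" unfolding x_def using bB by (rule closed)
  have "y \<le> x" if "y \<in> D" for y
    unfolding x_def using that rb bB bdd
    by (intro cSup_upper) (auto intro: bdd_above_mono)
  then have "s \<le> T x"
    using C(3) D(3) mono by (auto simp: isLub_def leastP_def isUb_def setle_def setge_def)
  then have Tx: "T x = s" using upper[OF x] by (rule antisym[rotated])
  have "y \<le> x" if y: "y \<in> B" for y
  proof -
    \<comment> \<open>A sequence taking only the values \<open>y\<close> and \<open>x\<close>, which
      turns sequential closure into closure under binary suprema.\<close>
    define c where "c = (\<lambda>n::nat. if n = 0 then y else x)"
    have rc: "range c = {y, x}" by (auto simp: c_def image_def)
    have "(SUP n. c n) = sup y x" unfolding rc by (simp add: cSup_insert)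
    then have m: "sup y x \<in> B" using closed[of c] rc x y by auto
    \<comment> \<open>\<open>T\<close> is at most \<open>s\<close> on \<open>B\<close> and equals
      \<open>s\<close> at \<open>x\<close>, so passing from \<open>x\<close> to
      \<open>sup y x\<close> cannot raise it; strict positivity then forces the two to
      coincide.\<close>
    have "T (sup y x - x) \<le> 0"
      using upper[OF m] Tpos Tx by (simp add: positive_operator_def linear_diff)
    moreover have "0 \<le> T (sup y x - x)" using Tpos by (simp add: positive_operator_def)
    ultimately have "sup y x - x = 0"
      by (intro strictly_positive_eq_0[OF T]) auto
    then show ?thesis by (metis eq_iff_diff_eq_0 sup.cobounded1)
  qed
  then show thesis using that x by blast
qed

theorem theorem8p2:
  fixes T :: "'e::order_complete_riesz_space \<Rightarrow> 'f::order_complete_riesz_space"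
    and B :: "'e set"
  assumes "strictly_positive_operator T"
    and "B \<noteq> {}" and "B \<subseteq> {x. 0 \<le> x}" and "bdd_above B"
  shows
    "((\<exists>x\<in>B. B \<subseteq> band hull {x}) \<longleftrightarrow> (\<exists>z\<in>B. \<exists>U V. band_splitting T B z U V)) \<and>
     (\<forall>x\<in>B. \<forall>z\<in>B. \<forall>U V. B \<subseteq> band hull {x} \<and> band_splitting T B z U V \<longrightarrow>
        band hull B = band hull {x} \<and> band hull B = band hull {z} \<and>
        U = component T (band hull B) \<and> V = component T (disjoint_compl (band hull B)) \<and>
        is_operator_inf U V (\<lambda>_. 0) \<and> is_operator_sup U V T) \<and>
     (\<forall>z\<in>B. \<forall>z'\<in>B. \<forall>U V U' V'.
        band_splitting T B z U V \<and> band_splitting T B z' U' V' \<longrightarrow> U = U' \<and> V = V') \<and>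
     (countable_sup_property TYPE('f) \<and>
        (\<forall>b :: nat \<Rightarrow> 'e. range b \<subseteq> B \<longrightarrow> (SUP n. b n) \<in> B) \<longrightarrow>
        (\<exists>x\<in>B. B \<subseteq> band hull {x}))"
proof (intro conjI)
  note T = assms(1) and B = assms(3)
  note Tpos = strictly_positive_imp_positive[OF T]
  note sub = band_splitting_imp_subset[OF T B] and eqs = band_splitting_eq[OF T B]
  show "(\<exists>x\<in>B. B \<subseteq> band hull {x}) \<longleftrightarrow> (\<exists>z\<in>B. \<exists>U V. band_splitting T B z U V)"
    using band_splitting_exists[OF Tpos] sub by meson
  show "\<forall>x\<in>B. \<forall>z\<in>B. \<forall>U V. B \<subseteq> band hull {x} \<and> band_splitting T B z U V \<longrightarrow>
        band hull B = band hull {x} \<and> band hull B = band hull {z} \<and>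
        U = component T (band hull B) \<and> V = component T (disjoint_compl (band hull B)) \<and>
        is_operator_inf U V (\<lambda>_. 0) \<and> is_operator_sup U V T"
  proof (intro ballI allI impI, elim conjE)
    fix x z U V
    assume x: "x \<in> B" "B \<subseteq> band hull {x}" and z: "z \<in> B" "band_splitting T B z U V"
    show "band hull B = band hull {x} \<and> band hull B = band hull {z} \<and>
        U = component T (band hull B) \<and> V = component T (disjoint_compl (band hull B)) \<and>
        is_operator_inf U V (\<lambda>_. 0) \<and> is_operator_sup U V T"
      using band_hull_mono_eq[OF x] band_hull_mono_eq[OF z(1) sub[OF z(2)]]
        component_band[OF Tpos band_band_hull[of B]]
        component_disjoint_compl[OF Tpos band_band_hull[of B]]
        eqs[OF z] band_splitting_operator_inf_sup[OF T B z]
      by metis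
  qed
  \<comment> \<open>The formulas in \<open>eqs\<close> depend on \<open>T\<close> and
    \<open>B\<close> alone, so splittings at different points agree.\<close>
  show "\<forall>z\<in>B. \<forall>z'\<in>B. \<forall>U V U' V'.
        band_splitting T B z U V \<and> band_splitting T B z' U' V' \<longrightarrow> U = U' \<and> V = V'"
    using eqs by metis
  show "countable_sup_property TYPE('f) \<and>
        (\<forall>b :: nat \<Rightarrow> 'e. range b \<subseteq> B \<longrightarrow> (SUP n. b n) \<in> B) \<longrightarrow>
        (\<exists>x\<in>B. B \<subseteq> band hull {x})"
  proof (intro impI, elim conjE)
    assume csp: "countable_sup_property TYPE('f)"
      and closed: "\<forall>b :: nat \<Rightarrow> 'e. range b \<subseteq> B \<longrightarrow> (SUP n. b n) \<in> B"
    obtain x where x: "x \<in> B" "\<And>b. b \<in> B \<Longrightarrow> b \<le> x"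
      using countable_sup_property_maximum[OF T assms(2,4) csp] closed by metis
    have xx: "x \<in> band hull {x}" using hull_subset[of "{x}" band] by simp
    \<comment> \<open>Every \<open>b\<close> lies between 0 and the largest element
      \<open>x\<close>, so solidity of the band suffices.\<close>
    have "b \<in> band hull {x}" if b: "b \<in> B" for b
    proof (rule riesz_ideal_solid[OF band_ideal[OF band_band_hull] xx _ x(2)[OF b]])
      show "0 \<le> b" using b B by blast
    qed
    then show "\<exists>x\<in>B. B \<subseteq> band hull {x}" using x(1) by blast
  qed
qed

end
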